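(* Let $f:\mathbb{R}^d\to\mathbb{R}$ be continuous with a unique $x^*\in\mathbb{R}^d$ such that $f(x^* )=\min f=:\underline f$; assume there is $L_f>0$ with $|f(x)-f(y)|\le L_f(1+|x|+|y|)|x-y|$ for all $x,y\in\mathbb{R}^d$, and there are $c_\ell,c_u,M>0$ with $f(x)-\underline f\le c_u(|x|^2+1)$ for all $x\in\mathbb{R}^d$ and $c_\ell|x|^2\le f(x)-\underline f$ for $|x|\ge M$. Let $\nu$ be a probability measure on $\mathbb{R}^d$ satisfying $$\mathbb E_\nu[|x|^2]\le c_2\quad\text{and}\quad\nu(B_s(x^* ))\ge C_s>0\ \text{ for any }s>0.$$ For $\alpha>0$ define the probability measure $$\eta_\nu^\alpha(A):=\frac{\int_Ae^{-\alpha f(x)}\nu(dx)}{\int_{\mathbb{R}^d}e^{-\alpha f(y)}\nu(dy)},\quad A\in\mathcal B(\mathbb{R}^d).$$ Then for any $\varepsilon>0$, $$\eta_\nu^\alpha(\{x\in\mathbb{R}^d:|x-x^*|\ge\varepsilon\})\to0\quad\text{as }\alpha\to\infty,$$ and $$\mathbb E_{\eta_\nu^\alpha}[x]=\frac{\int_{\mathbb{R}^d}xe^{-\alpha f(x)}\nu(dx)}{\int_{\mathbb{R}^d}e^{-\alpha f(x)}\nu(dx)}\to x^*\quad\text{as }\alpha\to\infty.$$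
   Context: $B_s(x^* )$ is the ball of radius $s$ around $x^*$. *)

theory Defs
  imports "HOL-Probability.Probability"
begin

definition gibbs_reweighting ::
  "'a measure \<Rightarrow> ('a \<Rightarrow> real) \<Rightarrow> real \<Rightarrow> 'a measure" where
  "gibbs_reweighting \<nu> f \<alpha> =
     density \<nu> (\<lambda>x. ennreal (exp (- \<alpha> * f x) / (LINT y|\<nu>. exp (- \<alpha> * f y))))"

(* The lemmas below check that, for f bounded below and \<alpha> > 0, the definition
   by a density is the probability measure given by the quotient of integrals
   A \<mapsto> (\<integral>_A e^{-\<alpha> f} d\<nu>) / (\<integral> e^{-\<alpha> f} d\<nu>). *)

lemma gibbs_weight_integrable:
  fixes f :: "'a \<Rightarrow> real"
  assumes "prob_space \<nu>" and [measurable]: "f \<in> borel_measurable \<nu>"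
    and lower: "\<And>x. m \<le> f x" and "\<alpha> > 0"
  shows "integrable \<nu> (\<lambda>x. exp (- \<alpha> * f x))"
    and "(LINT x|\<nu>. exp (- \<alpha> * f x)) > 0"
proof -
  interpret prob_space \<nu> by fact
  show int: "integrable \<nu> (\<lambda>x. exp (- \<alpha> * f x))"
    by (rule integrable_const_bound[where B = "exp (- \<alpha> * m)"])
       (use lower \<open>\<alpha> > 0\<close> in auto)
  have "(LINT x|\<nu>. exp (- \<alpha> * f x)) \<noteq> 0"
    using integral_nonneg_eq_0_iff_AE[OF int] AE_False by simp
  moreover have "(LINT x|\<nu>. exp (- \<alpha> * f x)) \<ge> 0"
    by (rule integral_nonneg_AE) simp
  ultimately show "(LINT x|\<nu>. exp (- \<alpha> * f x)) > 0" by linarith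
qed

lemma emeasure_gibbs_reweighting:
  fixes f :: "'a \<Rightarrow> real"
  assumes "prob_space \<nu>" and [measurable]: "f \<in> borel_measurable \<nu>"
    and lower: "\<And>x. m \<le> f x" and "\<alpha> > 0" and A [measurable]: "A \<in> sets \<nu>"
  shows "emeasure (gibbs_reweighting \<nu> f \<alpha>) A =
    ennreal ((LINT x:A|\<nu>. exp (- \<alpha> * f x)) / (LINT x|\<nu>. exp (- \<alpha> * f x)))"
proof -
  define Z where "Z = (LINT x|\<nu>. exp (- \<alpha> * f x))"
  note weight = gibbs_weight_integrable[OF assms(1-4)]
  have Z: "Z > 0" using weight(2) by (simp add: Z_def)
  have int: "integrable \<nu> (\<lambda>x. exp (- \<alpha> * f x) / Z * indicator A x)"
    using weight(1) by (intro integrable_real_mult_indicator A integrable_divide_zero) simp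
  have "emeasure (gibbs_reweighting \<nu> f \<alpha>) A =
      (\<integral>\<^sup>+x. ennreal (exp (- \<alpha> * f x) / Z * indicator A x) \<partial>\<nu>)"
    unfolding gibbs_reweighting_def Z_def[symmetric]
    by (subst emeasure_density) (auto intro!: nn_integral_cong split: split_indicator)
  also have "\<dots> = ennreal (LINT x|\<nu>. exp (- \<alpha> * f x) / Z * indicator A x)"
    by (rule nn_integral_eq_integral[OF int]) (use Z in auto)
  also have "(LINT x|\<nu>. exp (- \<alpha> * f x) / Z * indicator A x) =
      (LINT x|\<nu>. indicator A x *\<^sub>R exp (- \<alpha> * f x) / Z)"
    by (rule Bochner_Integration.integral_cong) auto
  also have "\<dots> = (LINT x:A|\<nu>. exp (- \<alpha> * f x)) / Z"
    by (simp add: set_lebesgue_integral_def)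
  finally show ?thesis by (simp add: Z_def)
qed

lemma prob_space_gibbs_reweighting:
  fixes f :: "'a \<Rightarrow> real"
  assumes "prob_space \<nu>" and "f \<in> borel_measurable \<nu>"
    and "\<And>x. m \<le> f x" and "\<alpha> > 0"
  shows "prob_space (gibbs_reweighting \<nu> f \<alpha>)"
proof (rule prob_spaceI)
  have "(LINT x:space \<nu>|\<nu>. exp (- \<alpha> * f x)) = (LINT x|\<nu>. exp (- \<alpha> * f x))"
    by (rule set_integral_space) (rule gibbs_weight_integrable[OF assms])
  then show "emeasure (gibbs_reweighting \<nu> f \<alpha>) (space (gibbs_reweighting \<nu> f \<alpha>)) = 1"
    using emeasure_gibbs_reweighting[OF assms sets.top] gibbs_weight_integrable(2)[OF assms]
    by (simp add: gibbs_reweighting_def)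
qed

end

theory Submission
  imports Defs
begin

text \<open>
  Laplace's principle. Away from \<open>xstar\<close> the coercive function \<open>f\<close> exceeds its minimum by some
  \<open>b > 0\<close>, while by continuity it stays below \<open>fmin + b/2\<close> on a small ball around \<open>xstar\<close>, which
  has positive mass. Comparing the weight \<open>exp (-\<alpha> f)\<close> on the two regions, the reweighted integral
  of any \<open>\<nu>\<close>-integrable \<open>h \<ge> 0\<close> over \<open>norm (x - xstar) \<ge> \<epsilon>\<close> is \<open>O(exp (-\<alpha> b/2))\<close>. The choice
  \<open>h = 1\<close> gives concentration, and \<open>h x = norm (x - xstar)\<close> gives convergence of the mean.
\<close>

text \<open>Since \<open>f\<close> is bounded below by \<open>m\<close>, the weight is at most
  \<open>exp (- \<alpha> * m)\<close>, so integrability passes from \<nu> to the weighted integrand.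
  The values of \<open>g\<close> lie in a Banach space so that one statement covers both real tail
  integrands and the vector mean.\<close>

lemma
  fixes f :: "'a \<Rightarrow> real" and g :: "'a \<Rightarrow> 'b :: {banach, second_countable_topology}"
  assumes "prob_space \<nu>" and f: "f \<in> borel_measurable \<nu>"
    and lower: "\<And>x. m \<le> f x" and \<alpha>: "\<alpha> > 0" and g: "integrable \<nu> g"
  shows integrable_gibbs_weight_scaleR: "integrable \<nu> (\<lambda>x. exp (- \<alpha> * f x) *\<^sub>R g x)"
    and integrable_gibbs_reweighting: "integrable (gibbs_reweighting \<nu> f \<alpha>) g"
    and integral_gibbs_reweighting: "(LINT x|gibbs_reweighting \<nu> f \<alpha>. g x) =
      (LINT x|\<nu>. exp (- \<alpha> * f x) *\<^sub>R g x) /\<^sub>R (LINT x|\<nu>. exp (- \<alpha> * f x))"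
proof -
  note [measurable] = f borel_measurable_integrable[OF g]
  define Z where "Z = (LINT x|\<nu>. exp (- \<alpha> * f x))"
  have Z: "Z > 0"
    using gibbs_weight_integrable(2)[OF assms(1-4)] by (simp add: Z_def)
  show int: "integrable \<nu> (\<lambda>x. exp (- \<alpha> * f x) *\<^sub>R g x)"
  proof (rule Bochner_Integration.integrable_bound)
    show "integrable \<nu> (\<lambda>x. exp (- \<alpha> * m) *\<^sub>R g x)" using g by simp
    show "AE x in \<nu>. norm (exp (- \<alpha> * f x) *\<^sub>R g x) \<le> norm (exp (- \<alpha> * m) *\<^sub>R g x)"
      using lower \<alpha> by (auto intro!: mult_right_mono)
  qed measurable
  \<comment> \<open>The scalars are regrouped so that the normalising constant becomes a factor in
    front of the integral.\<close>
  have weight: "(\<lambda>x. (exp (- \<alpha> * f x) / Z) *\<^sub>R g x) =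
      (\<lambda>x. inverse Z *\<^sub>R (exp (- \<alpha> * f x) *\<^sub>R g x))"
    by (simp add: divide_inverse mult.commute)
  show "integrable (gibbs_reweighting \<nu> f \<alpha>) g"
    unfolding gibbs_reweighting_def Z_def[symmetric]
    using Z integrable_scaleR_right[OF int, of "inverse Z", folded weight]
    by (subst integrable_density) auto
  show "(LINT x|gibbs_reweighting \<nu> f \<alpha>. g x) =
      (LINT x|\<nu>. exp (- \<alpha> * f x) *\<^sub>R g x) /\<^sub>R (LINT x|\<nu>. exp (- \<alpha> * f x))"
    unfolding gibbs_reweighting_def Z_def[symmetric]
    using Z integral_scaleR_right[of \<nu> "inverse Z" "\<lambda>x. exp (- \<alpha> * f x) *\<^sub>R g x", folded weight]
    by (subst integral_density) auto
qed

text \<open>The numerator is at most \<open>exp (- \<alpha> * b)\<close> times the integral of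
  \<open>h\<close>, because \<open>f\<close> is at least \<open>b\<close> on \<open>A\<close>. The
  normalising integral is at least \<open>exp (- \<alpha> * a)\<close> times the mass of
  \<open>B\<close>, because discarding the complement of \<open>B\<close> only decreases it.\<close>

lemma gibbs_reweighting_tail_le:
  fixes f h :: "'a \<Rightarrow> real"
  assumes "prob_space \<nu>" and f [measurable]: "f \<in> borel_measurable \<nu>"
    and lower: "\<And>x. m \<le> f x" and \<alpha>: "\<alpha> > 0"
    and h: "integrable \<nu> h" "\<And>x. 0 \<le> h x"
    and A [measurable]: "A \<in> sets \<nu>" and fA: "\<And>x. x \<in> A \<Longrightarrow> b \<le> f x"
    and B [measurable]: "B \<in> sets \<nu>" and fB: "\<And>x. x \<in> B \<Longrightarrow> f x \<le> a"
    and pos: "measure \<nu> B > 0"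
  shows "(LINT x|gibbs_reweighting \<nu> f \<alpha>. indicator A x * h x)
    \<le> exp (- \<alpha> * (b - a)) * (LINT x|\<nu>. h x) / measure \<nu> B"
proof -
  interpret prob_space \<nu> by fact
  define Z where "Z = (LINT x|\<nu>. exp (- \<alpha> * f x))"
  have hA: "integrable \<nu> (\<lambda>x. indicator A x * h x)"
    using integrable_mult_indicator[OF A h(1)] by simp
  have "exp (- \<alpha> * a) * measure \<nu> B = (LINT x|\<nu>. exp (- \<alpha> * a) * indicator B x)"
    by simp
  also have "\<dots> \<le> Z"
    unfolding Z_def using fB \<alpha>
    by (intro integral_mono gibbs_weight_integrable(1)[OF assms(1-4)])
       (auto simp: less_top[symmetric] split: split_indicator)
  finally have Z: "exp (- \<alpha> * a) * measure \<nu> B \<le> Z" .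
  \<comment> \<open>Off \<open>A\<close> the left integrand vanishes, so there the comparison only
    uses that \<open>h\<close> is nonnegative.\<close>
  have "(LINT x|\<nu>. exp (- \<alpha> * f x) *\<^sub>R (indicator A x * h x)) \<le> (LINT x|\<nu>. exp (- \<alpha> * b) * h x)"
    using h fA \<alpha> integrable_gibbs_weight_scaleR[OF assms(1-4) hA]
    by (intro integral_mono) (auto intro!: mult_right_mono split: split_indicator)
  then have num: "(LINT x|\<nu>. exp (- \<alpha> * f x) *\<^sub>R (indicator A x * h x)) \<le> exp (- \<alpha> * b) * (LINT x|\<nu>. h x)"
    by simp
  have "(LINT x|gibbs_reweighting \<nu> f \<alpha>. indicator A x * h x) =
      (LINT x|\<nu>. exp (- \<alpha> * f x) *\<^sub>R (indicator A x * h x)) / Z"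
    by (subst integral_gibbs_reweighting[OF assms(1-4) hA]) (simp add: Z_def divide_inverse mult.commute)
  also have "\<dots> \<le> (exp (- \<alpha> * b) * (LINT x|\<nu>. h x)) / (exp (- \<alpha> * a) * measure \<nu> B)"
    using num Z pos h by (intro frac_le mult_nonneg_nonneg integral_nonneg) auto
  also have "\<dots> = exp (- \<alpha> * (b - a)) * (LINT x|\<nu>. h x) / measure \<nu> B"
  proof -
    have "exp (- \<alpha> * (b - a)) = exp (- \<alpha> * b) / exp (- \<alpha> * a)"
      by (simp add: exp_diff[symmetric] algebra_simps)
    then show ?thesis by simp
  qed
  finally show ?thesis .
qed

lemma gibbs_reweighting_tail_tendsto_0:
  fixes f h :: "'a \<Rightarrow> real"
  assumes "prob_space \<nu>" and "f \<in> borel_measurable \<nu>" and "\<And>x. m \<le> f x"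
    and h: "integrable \<nu> h" "\<And>x. 0 \<le> h x"
    and "A \<in> sets \<nu>" "\<And>x. x \<in> A \<Longrightarrow> b \<le> f x"
    and "B \<in> sets \<nu>" "\<And>x. x \<in> B \<Longrightarrow> f x \<le> a"
    and "measure \<nu> B > 0" and ab: "a < b"
  shows "((\<lambda>\<alpha>. LINT x|gibbs_reweighting \<nu> f \<alpha>. indicator A x * h x) \<longlongrightarrow> 0) at_top"
proof (rule tendsto_sandwich)
  let ?bd = "\<lambda>\<alpha>. exp (- \<alpha> * (b - a)) * (LINT x|\<nu>. h x) / measure \<nu> B"
  show "eventually (\<lambda>\<alpha>. 0 \<le> (LINT x|gibbs_reweighting \<nu> f \<alpha>. indicator A x * h x)) at_top"
    using h by (auto intro!: always_eventually integral_nonneg)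
  show "eventually (\<lambda>\<alpha>. (LINT x|gibbs_reweighting \<nu> f \<alpha>. indicator A x * h x) \<le> ?bd \<alpha>) at_top"
    using eventually_gt_at_top[of 0]
    by eventually_elim (rule gibbs_reweighting_tail_le[OF assms(1-3) _ assms(4-10)])
  \<comment> \<open>The strict gap between the levels \<open>a\<close> and \<open>b\<close> makes
    the exponential factor decay.\<close>
  have "filterlim (\<lambda>\<alpha>. \<alpha> * (b - a)) at_top at_top"
    using ab by (intro filterlim_at_top_mult_tendsto_pos[OF tendsto_const] filterlim_ident) auto
  then have "((\<lambda>\<alpha>. exp (- \<alpha> * (b - a))) \<longlongrightarrow> 0) at_top"
    by (auto intro!: filterlim_compose[OF exp_at_bot] simp: filterlim_uminus_at_bot)
  then show "(?bd \<longlongrightarrow> 0) at_top"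
    by (intro tendsto_eq_intros(1) tendsto_divide_zero tendsto_mult_left_zero)
qed simp

text \<open>Beyond radius \<open>M\<close> the gap is at least \<open>b0\<close>. The remaining
  points at distance at least \<epsilon> from \<open>p\<close> lie in a compact set, on which
  \<open>f\<close> attains its infimum; that value exceeds \<open>m\<close> because only
  \<open>p\<close> can have value \<open>m\<close> and \<open>p\<close> is excluded.\<close>

lemma coercive_unique_min_gap:
  fixes f :: "'a :: euclidean_space \<Rightarrow> real"
  assumes cont: "continuous_on UNIV f" and "\<And>x. m \<le> f x" and uniq: "\<And>x. f x = m \<Longrightarrow> x = p"
    and "b0 > 0" and far: "\<And>x. norm x \<ge> M \<Longrightarrow> m + b0 \<le> f x" and "\<epsilon> > 0"
  obtains b where "b > 0" "\<And>x. norm (x - p) \<ge> \<epsilon> \<Longrightarrow> m + b \<le> f x"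
proof -
  define K where "K = cball 0 M \<inter> {x. \<epsilon> \<le> norm (x - p)}"
  have "compact K"
    unfolding K_def by (intro compact_Int_closed compact_cball closed_Collect_le continuous_intros)
  show thesis
  proof (cases "K = {}")
    \<comment> \<open>Here every point at distance at least \<epsilon> from \<open>p\<close> has
      norm above \<open>M\<close>, so \<open>b0\<close> itself serves as the gap.\<close>
    case True
    then have "m + b0 \<le> f x" if "norm (x - p) \<ge> \<epsilon>" for x
      using that by (intro far) (force simp: K_def)
    with \<open>b0 > 0\<close> show thesis by (rule that)
  next
    case False
    obtain y where y: "y \<in> K" "\<And>x. x \<in> K \<Longrightarrow> f y \<le> f x"
      using continuous_attains_inf[OF \<open>compact K\<close> False continuous_on_subset[OF cont]] by blast
    have "f y \<noteq> m" using uniq[of y] y(1) \<open>\<epsilon> > 0\<close> by (auto simp: K_def)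
    then have "f y > m" using assms(2)[of y] by simp
    show thesis
    proof (rule that[of "min b0 (f y - m)"])
      show "min b0 (f y - m) > 0" using \<open>b0 > 0\<close> \<open>f y > m\<close> by simp
      fix x assume "norm (x - p) \<ge> \<epsilon>"
      then show "m + min b0 (f y - m) \<le> f x"
        using far[of x] y(2)[of x] by (cases "norm x \<ge> M") (auto simp: K_def)
    qed
  qed
qed

theorem lemma3p3:
  fixes f :: "real ^ 'd \<Rightarrow> real" and xstar :: "real ^ 'd"
    and fmin Lf cl cu M c2 :: real and C :: "real \<Rightarrow> real"
    and \<nu> :: "(real ^ 'd) measure"
  assumes f_cont: "continuous_on UNIV f"
    and f_min: "f xstar = fmin" "\<And>x. fmin \<le> f x"
    and f_min_unique: "\<And>x. f x = fmin \<Longrightarrow> x = xstar"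
    and Lf: "Lf > 0"
      "\<And>x y. \<bar>f x - f y\<bar> \<le> Lf * (1 + norm x + norm y) * norm (x - y)"
    and pos: "cl > 0" "cu > 0" "M > 0"
    and f_upper: "\<And>x. f x - fmin \<le> cu * ((norm x)\<^sup>2 + 1)"
    and f_lower: "\<And>x. norm x \<ge> M \<Longrightarrow> cl * (norm x)\<^sup>2 \<le> f x - fmin"
    and \<nu>_prob: "prob_space \<nu>" and \<nu>_sets: "sets \<nu> = sets borel"
    and \<nu>_moment: "integrable \<nu> (\<lambda>x. (norm x)\<^sup>2)" "(LINT x|\<nu>. (norm x)\<^sup>2) \<le> c2"
    and \<nu>_ball: "\<And>s. s > 0 \<Longrightarrow> C s > 0 \<and> measure \<nu> (ball xstar s) \<ge> C s"
  shows "(\<forall>\<epsilon>>0. ((\<lambda>\<alpha>. measure (gibbs_reweighting \<nu> f \<alpha>) {x. norm (x - xstar) \<ge> \<epsilon>})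
             \<longlongrightarrow> 0) at_top)
    \<and> (\<forall>\<alpha>>0. integrable (gibbs_reweighting \<nu> f \<alpha>) (\<lambda>x. x)
          \<and> (LINT x|gibbs_reweighting \<nu> f \<alpha>. x) =
              (LINT x|\<nu>. exp (- \<alpha> * f x) *\<^sub>R x) /\<^sub>R (LINT x|\<nu>. exp (- \<alpha> * f x)))
    \<and> ((\<lambda>\<alpha>. LINT x|gibbs_reweighting \<nu> f \<alpha>. x) \<longlongrightarrow> xstar) at_top"
proof -
  interpret prob_space \<nu> by fact
  have f_cont': "isCont f x" for x
    using f_cont by (simp add: continuous_on_eq_continuous_at)
  have f_meas: "f \<in> borel_measurable \<nu>"
    using borel_measurable_continuous_onI[OF f_cont] measurable_cong_sets[OF \<nu>_sets refl] by blast
  have id_meas: "(\<lambda>x. x) \<in> borel_measurable \<nu>"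
    using measurable_ident_sets[OF \<nu>_sets] .
  note prob = prob_space_gibbs_reweighting[OF \<nu>_prob f_meas f_min(2)]
  have id_int: "integrable \<nu> (\<lambda>x. x)"
  proof (rule Bochner_Integration.integrable_bound)
    show "integrable \<nu> (\<lambda>x. 1 + (norm x)\<^sup>2)" using \<nu>_moment(1) by simp
    show "AE x in \<nu>. norm x \<le> norm (1 + (norm x)\<^sup>2)"
    proof (rule AE_I2)
      fix x :: "real ^ 'd"
      \<comment> \<open>By this inequality the finite second moment controls the first
        moment.\<close>
      have "2 * norm x \<le> 1 + (norm x)\<^sup>2"
        using sum_squares_bound[of 1 "norm x"] by simp
      then show "norm x \<le> norm (1 + (norm x)\<^sup>2)"
        using norm_ge_zero[of x] unfolding real_norm_def by linarith
    qed
  qed (rule id_meas)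
  have dist_int: "integrable \<nu> (\<lambda>x. norm (x - xstar))"
    using id_int by simp

  have tail: "((\<lambda>\<alpha>. LINT x|gibbs_reweighting \<nu> f \<alpha>. indicator {x. norm (x - xstar) \<ge> \<epsilon>} x * h x)
      \<longlongrightarrow> 0) at_top"
    if "\<epsilon> > 0" "integrable \<nu> h" "\<And>x. 0 \<le> h x" for \<epsilon> and h :: "real ^ 'd \<Rightarrow> real"
  proof -
    \<comment> \<open>Quadratic growth is reduced to a constant gap \<open>cl * M\<^sup>2\<close>,
      positive since \<open>M > 0\<close>.\<close>
    have far: "fmin + cl * M\<^sup>2 \<le> f x" if "norm x \<ge> M" for x
    proof -
      have "cl * M\<^sup>2 \<le> cl * (norm x)\<^sup>2" using pos that by (intro mult_left_mono power_mono) auto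
      then show ?thesis using f_lower[OF that] by simp
    qed
    obtain b where b: "b > 0" "\<And>x. norm (x - xstar) \<ge> \<epsilon> \<Longrightarrow> fmin + b \<le> f x"
      using coercive_unique_min_gap[OF f_cont f_min(2) f_min_unique _ far \<open>\<epsilon> > 0\<close>] pos by auto
    \<comment> \<open>Half of the gap is spent on the ball, which leaves the levels
      \<open>fmin + b / 2\<close> near \<open>xstar\<close> and \<open>fmin + b\<close> far away
      strictly separated.\<close>
    obtain s where s: "s > 0" "\<And>x. dist x xstar < s \<Longrightarrow> dist (f x) (f xstar) < b / 2"
      using f_cont'[of xstar] b(1) unfolding continuous_at_eps_delta
      by (metis half_gt_zero dist_norm)
    show ?thesis
    proof (rule gibbs_reweighting_tail_tendsto_0[OF \<nu>_prob f_meas f_min(2) that(2,3)])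
      show "{x. norm (x - xstar) \<ge> \<epsilon>} \<in> sets \<nu>" "ball xstar s \<in> sets \<nu>"
        unfolding \<nu>_sets by measurable
      show "f x \<le> fmin + b / 2" if "x \<in> ball xstar s" for x
        using s(2)[of x] that f_min(1) unfolding mem_ball dist_real_def dist_commute[of xstar] by linarith
      show "measure \<nu> (ball xstar s) > 0" using \<nu>_ball[OF s(1)] by linarith
    qed (use b in auto)
  qed

  have concentration: "((\<lambda>\<alpha>. measure (gibbs_reweighting \<nu> f \<alpha>) {x. norm (x - xstar) \<ge> \<epsilon>}) \<longlongrightarrow> 0) at_top"
    if "\<epsilon> > 0" for \<epsilon>
  proof -
    have "measure (gibbs_reweighting \<nu> f \<alpha>) {x. norm (x - xstar) \<ge> \<epsilon>} =
        (LINT x|gibbs_reweighting \<nu> f \<alpha>. indicator {x. norm (x - xstar) \<ge> \<epsilon>} x * 1)" for \<alpha>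
      using sets_eq_imp_space_eq[OF \<nu>_sets] by (simp add: gibbs_reweighting_def)
    then show ?thesis using tail[OF that, of "\<lambda>_. 1"] by simp
  qed

  have mean: "((\<lambda>\<alpha>. LINT x|gibbs_reweighting \<nu> f \<alpha>. x) \<longlongrightarrow> xstar) at_top"
  proof (rule tendstoI)
    fix e :: real assume "e > 0"
    \<comment> \<open>The error budget is split: points outside \<open>?A\<close> contribute at most
      \<open>e / 2\<close> under a probability measure, and the contribution of \<open>?A\<close> is
      eventually below \<open>e / 2\<close> by \<open>tail\<close>.\<close>
    let ?A = "{x. norm (x - xstar) \<ge> e / 2}"
    have "eventually (\<lambda>\<alpha>. (LINT x|gibbs_reweighting \<nu> f \<alpha>. indicator ?A x * norm (x - xstar)) < e / 2) at_top"
      by (rule order_tendstoD(2)[OF tail[OF _ dist_int]]) (use \<open>e > 0\<close> in simp_all)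
    then show "eventually (\<lambda>\<alpha>. dist (LINT x|gibbs_reweighting \<nu> f \<alpha>. x) xstar < e) at_top"
      using eventually_gt_at_top[of 0]
    proof eventually_elim
      case (elim \<alpha>)
      interpret G: prob_space "gibbs_reweighting \<nu> f \<alpha>" by (rule prob) (rule elim)
      note G_int = integrable_gibbs_reweighting[OF \<nu>_prob f_meas f_min(2) elim(2)]
      have "?A \<in> sets \<nu>" unfolding \<nu>_sets by measurable
      then have tail_int: "integrable (gibbs_reweighting \<nu> f \<alpha>) (\<lambda>x. indicator ?A x * norm (x - xstar))"
        using integrable_mult_indicator[OF _ dist_int] unfolding real_scaleR_def by (intro G_int)
      \<comment> \<open>Total mass 1 allows \<open>xstar\<close> to move under the integral; the
        norm of the integral is then at most the integral of the norm.\<close>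
      have "(LINT x|gibbs_reweighting \<nu> f \<alpha>. x) - xstar = (LINT x|gibbs_reweighting \<nu> f \<alpha>. x - xstar)"
        using G_int[OF id_int] by (simp add: G.prob_space)
      then have "dist (LINT x|gibbs_reweighting \<nu> f \<alpha>. x) xstar
          \<le> (LINT x|gibbs_reweighting \<nu> f \<alpha>. norm (x - xstar))"
        by (simp add: dist_norm)
      also have "\<dots> \<le> (LINT x|gibbs_reweighting \<nu> f \<alpha>. e / 2 + indicator ?A x * norm (x - xstar))"
        using G_int[OF dist_int] tail_int \<open>e > 0\<close>
        by (intro integral_mono) (auto split: split_indicator)
      also have "\<dots> = e / 2 + (LINT x|gibbs_reweighting \<nu> f \<alpha>. indicator ?A x * norm (x - xstar))"
        using tail_int by (simp add: G.prob_space)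
      finally show ?case using elim(1) by simp
    qed
  qed

  show ?thesis
    using concentration mean integrable_gibbs_reweighting[OF \<nu>_prob f_meas f_min(2) _ id_int]
      integral_gibbs_reweighting[OF \<nu>_prob f_meas f_min(2) _ id_int]
    by blast
qed

end
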